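(* Let $G$ be a finite transitive permutation group on $\Omega$ and let $H_G$ be the subgroup generated by all elements of $G$ fixing at least one point of $\Omega$. Suppose that $H_G$ is a proper subgroup of $G$ containing no derangements. Then $G$ has the EKR-module property.
   Context: A derangement is an element with no fixed point. A subset $\mathcal{F}\subseteq G$ is intersecting if for all $g,h\in\mathcal{F}$ some $\omega\in\Omega$ has $\omega^g=\omega^h$. For $\omega,\omega'\in\Omega$ let $G_{\omega\to\omega'}=\{g\in G:\omega^g=\omega'\}$ (the canonical intersecting sets). $G$ has the EKR-module property if the characteristic vector (in $\mathbb{R}^G$) of every intersecting set of maximum size is a linear combination of the characteristic vectors of the canonical intersecting sets. *)

theory Defs
  imports "HOL-Algebra.Algebra" "HOL-Library.Indicator_Function"
begin

text \<open>
  A permutation group on \<open>\<Omega>\<close> is a subgroup \<open>G\<close> of \<^term>\<open>BijGroup \<Omega>\<close>, so its elements are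
  functions and the image of \<open>x\<close> under \<open>g\<close> is \<open>g x\<close>. \<^term>\<open>BijGroup \<Omega>\<close> composes from right to
  left, whereas the exponential notation for images composes from left to right. None of the
  notions below depends on this choice: reversing the multiplication changes neither which sets
  are subgroups nor which subgroup a set generates.
\<close>

definition derangement :: "'a set \<Rightarrow> ('a \<Rightarrow> 'a) \<Rightarrow> bool" where
  "derangement \<Omega> g \<longleftrightarrow> (\<forall>x\<in>\<Omega>. g x \<noteq> x)"

definition intersecting :: "'a set \<Rightarrow> ('a \<Rightarrow> 'a) set \<Rightarrow> ('a \<Rightarrow> 'a) set \<Rightarrow> bool" where
  "intersecting \<Omega> G F \<longleftrightarrow> F \<subseteq> G \<and> (\<forall>g\<in>F. \<forall>h\<in>F. \<exists>x\<in>\<Omega>. g x = h x)"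

definition max_intersecting :: "'a set \<Rightarrow> ('a \<Rightarrow> 'a) set \<Rightarrow> ('a \<Rightarrow> 'a) set \<Rightarrow> bool" where
  "max_intersecting \<Omega> G F \<longleftrightarrow>
     intersecting \<Omega> G F \<and> (\<forall>F'. intersecting \<Omega> G F' \<longrightarrow> card F' \<le> card F)"

definition canonical_intersecting :: "('a \<Rightarrow> 'a) set \<Rightarrow> 'a \<Rightarrow> 'a \<Rightarrow> ('a \<Rightarrow> 'a) set" where
  "canonical_intersecting G x y = {g \<in> G. g x = y}"

text \<open>
  Vectors in \<open>\<real>\<^sup>G\<close> are real-valued functions compared on \<open>G\<close> only. The sum is meaningful for
  finite \<open>\<Omega>\<close>.
\<close>

definition EKR_module_property :: "'a set \<Rightarrow> ('a \<Rightarrow> 'a) set \<Rightarrow> bool" where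
  "EKR_module_property \<Omega> G \<longleftrightarrow>
     (\<forall>F. max_intersecting \<Omega> G F \<longrightarrow>
        (\<exists>c :: 'a \<Rightarrow> 'a \<Rightarrow> real. \<forall>g\<in>G.
           indicator F g =
             (\<Sum>x\<in>\<Omega>. \<Sum>y\<in>\<Omega>. c x y * indicator (canonical_intersecting G x y) g)))"

definition fixing_subgroup :: "'a set \<Rightarrow> ('a \<Rightarrow> 'a) set \<Rightarrow> ('a \<Rightarrow> 'a) set" where
  "fixing_subgroup \<Omega> G = generate (BijGroup \<Omega>) {g \<in> G. \<exists>x\<in>\<Omega>. g x = x}"

end

theory Submission
  imports Defs
begin

text \<open>
  Write \<open>H\<close> for \<^term>\<open>fixing_subgroup \<Omega> G\<close>. Every non-derangement of \<open>G\<close> lies in \<open>H\<close> and every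
  element of \<open>H\<close> has a fixed point, so \<open>g\<close> and \<open>h\<close> agree at some point iff \<open>g\<^sup>-\<^sup>1h \<in> H\<close>. Agreeing
  somewhere is therefore an equivalence relation on \<open>G\<close>, and a maximum intersecting set \<open>F\<close> is one
  of its classes. Hence, for any fixed \<open>x \<in> \<Omega>\<close>, \<open>F\<close> is the disjoint union of the canonical
  intersecting sets from \<open>x\<close> to the points of \<open>{k x | k \<in> F}\<close>.
\<close>

lemma finite_Bij: "finite S \<Longrightarrow> finite (Bij S)"
proof (rule finite_subset)
  show "Bij S \<subseteq> (\<Pi>\<^sub>E x\<in>S. S)"
    by (auto simp: Bij_def PiE_def bij_betw_def)
qed (auto intro: finite_PiE)

text \<open>Composition runs from right to left, so with the inverse as the left factor
  \<open>x\<close> goes to \<open>h x\<close> and then back along \<open>g\<close>. It returns to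
  \<open>x\<close> exactly when \<open>h x = g x\<close>.\<close>

lemma inv_mult_BijGroup_fixes_iff:
  assumes "g \<in> Bij S" "h \<in> Bij S" "x \<in> S"
  shows "(inv\<^bsub>BijGroup S\<^esub> g \<otimes>\<^bsub>BijGroup S\<^esub> h) x = x \<longleftrightarrow> g x = h x"
proof -
  have g: "bij_betw g S S" and h: "h x \<in> S"
    using assms by (auto simp: Bij_def bij_betw_def)
  \<comment> \<open>Multiplication in \<open>BijGroup S\<close> is itself restricted to
    \<open>Bij S\<close>, so it unfolds to \<open>compose\<close> only once both factors are known
    to lie there.\<close>
  have "(\<lambda>x\<in>S. inv_into S g x) \<in> Bij S"
    using assms(1) by (rule restrict_inv_into_Bij)
  then have "(inv\<^bsub>BijGroup S\<^esub> g \<otimes>\<^bsub>BijGroup S\<^esub> h) x = inv_into S g (h x)"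
    unfolding inv_BijGroup[OF assms(1)] using assms h by (simp add: BijGroup_def compose_def)
  moreover have "inv_into S g (h x) = x \<longleftrightarrow> g x = h x"
    using g h assms(3) by (metis bij_betw_inv_into_left bij_betw_inv_into_right)
  ultimately show ?thesis by simp
qed

lemma agree_iff_inv_mult_in_fixing_subgroup:
  assumes G: "subgroup G (BijGroup \<Omega>)"
    and H: "\<forall>h\<in>fixing_subgroup \<Omega> G. \<not> derangement \<Omega> h"
    and "g \<in> G" "h \<in> G"
  shows "(\<exists>x\<in>\<Omega>. g x = h x) \<longleftrightarrow>
    inv\<^bsub>BijGroup \<Omega>\<^esub> g \<otimes>\<^bsub>BijGroup \<Omega>\<^esub> h \<in> fixing_subgroup \<Omega> G" (is "_ \<longleftrightarrow> ?d \<in> _")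
proof -
  have "G \<subseteq> Bij \<Omega>"
    using subgroup.subset[OF G] by (simp add: BijGroup_def)
  then have fixes_iff: "?d x = x \<longleftrightarrow> g x = h x" if "x \<in> \<Omega>" for x
    using that assms(3,4) by (intro inv_mult_BijGroup_fixes_iff) auto
  have "?d \<in> G"
    using assms(3,4) by (intro subgroup.m_closed[OF G] subgroup.m_inv_closed[OF G])
  then have "?d \<in> fixing_subgroup \<Omega> G" if "\<exists>x\<in>\<Omega>. ?d x = x"
    using that unfolding fixing_subgroup_def by (intro generate.incl) auto
  moreover have "\<exists>x\<in>\<Omega>. ?d x = x" if "?d \<in> fixing_subgroup \<Omega> G"
    using that H by (auto simp: derangement_def)
  ultimately show ?thesis
    using fixes_iff by auto
qed

text \<open>The product of f^-1 g and g^-1 h telescopes to f^-1 h, and the generated subgroup is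
  closed under products.\<close>

lemma agree_trans:
  assumes G: "subgroup G (BijGroup \<Omega>)"
    and H: "\<forall>h\<in>fixing_subgroup \<Omega> G. \<not> derangement \<Omega> h"
    and mem: "f \<in> G" "g \<in> G" "h \<in> G"
    and agree: "\<exists>x\<in>\<Omega>. f x = g x" "\<exists>x\<in>\<Omega>. g x = h x"
  shows "\<exists>x\<in>\<Omega>. f x = h x"
proof -
  interpret B: group "BijGroup \<Omega>" by (rule group_BijGroup)
  let ?i = "\<lambda>g. inv\<^bsub>BijGroup \<Omega>\<^esub> g" and ?m = "\<lambda>g h. g \<otimes>\<^bsub>BijGroup \<Omega>\<^esub> h"
  have carr: "f \<in> carrier (BijGroup \<Omega>)" "g \<in> carrier (BijGroup \<Omega>)" "h \<in> carrier (BijGroup \<Omega>)"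
    using mem subgroup.subset[OF G] by auto
  have "?m (?i f) g \<in> fixing_subgroup \<Omega> G" "?m (?i g) h \<in> fixing_subgroup \<Omega> G"
    using agree agree_iff_inv_mult_in_fixing_subgroup[OF G H] mem by simp_all
  then have prod: "?m (?m (?i f) g) (?m (?i g) h) \<in> fixing_subgroup \<Omega> G"
    unfolding fixing_subgroup_def by (rule generate.eng)
  have "?m (?m (?i f) g) (?m (?i g) h) = ?m (?i f) (?m (?m g (?i g)) h)"
    using carr by (simp only: B.m_assoc B.m_closed B.inv_closed)
  with carr have "?m (?m (?i f) g) (?m (?i g) h) = ?m (?i f) h"
    by (simp only: B.r_inv B.l_one)
  with prod show ?thesis
    using agree_iff_inv_mult_in_fixing_subgroup[OF G H mem(1,3)] by simp
qed

text \<open>If \<open>u\<close> were outside \<open>F\<close>, transitivity through \<open>k\<close>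
  would make \<open>u\<close> agree somewhere with every member of \<open>F\<close>, so
  \<open>insert u F\<close> would be a larger intersecting set.\<close>

lemma max_intersecting_absorbs_agreeing:
  assumes fin: "finite \<Omega>" and G: "subgroup G (BijGroup \<Omega>)"
    and H: "\<forall>h\<in>fixing_subgroup \<Omega> G. \<not> derangement \<Omega> h"
    and F: "max_intersecting \<Omega> G F"
    and u: "u \<in> G" and k: "k \<in> F" and x: "x \<in> \<Omega>" "u x = k x"
  shows "u \<in> F"
proof (rule ccontr)
  assume "u \<notin> F"
  have FG: "F \<subseteq> G" and int: "\<And>g h. g \<in> F \<Longrightarrow> h \<in> F \<Longrightarrow> \<exists>x\<in>\<Omega>. g x = h x"
    using F by (auto simp: max_intersecting_def intersecting_def)
  have "\<exists>y\<in>\<Omega>. u y = f y" if "f \<in> F" for f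
  proof (rule agree_trans[OF G H u])
    show "\<exists>y\<in>\<Omega>. u y = k y" using x by blast
    show "\<exists>y\<in>\<Omega>. k y = f y" by (rule int[OF k that])
  qed (use FG k that in auto)
  then have "intersecting \<Omega> G (insert u F)"
    using FG u int x(1) unfolding intersecting_def by (metis insert_iff insert_subset)
  then have "card (insert u F) \<le> card F"
    using F by (simp add: max_intersecting_def)
  \<comment> \<open>Inserting a new element raises \<open>card\<close> only for a finite set, since
    \<open>card\<close> is 0 on infinite sets.\<close>
  moreover have "finite F"
    using FG subgroup.subset[OF G] finite_Bij[OF fin]
    by (auto simp: BijGroup_def intro: finite_subset)
  ultimately show False
    using \<open>u \<notin> F\<close> by simp
qed

theorem theorem5p2:
  fixes \<Omega> :: "'a set" and G :: "('a \<Rightarrow> 'a) set"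
  assumes "finite \<Omega>"
    and "subgroup G (BijGroup \<Omega>)"
    and "transitive_action (BijGroup \<Omega>\<lparr>carrier := G\<rparr>) \<Omega> (\<lambda>g. g)"
    and "fixing_subgroup \<Omega> G \<subset> G"
    and "\<forall>h\<in>fixing_subgroup \<Omega> G. \<not> derangement \<Omega> h"
  shows "EKR_module_property \<Omega> G"
  unfolding EKR_module_property_def
proof (intro allI impI)
  fix F assume F: "max_intersecting \<Omega> G F"
  \<comment> \<open>The identity is not a derangement, so it fixes some point; this supplies the
    base point \<open>x\<close>.\<close>
  have "\<one>\<^bsub>BijGroup \<Omega>\<^esub> \<in> fixing_subgroup \<Omega> G"
    unfolding fixing_subgroup_def by (rule generate.one)
  then obtain x where x: "x \<in> \<Omega>"
    using assms(5) by (auto simp: derangement_def)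
  \<comment> \<open>Only canonical sets with source \<open>x\<close> get weight: 1 if the target is
    the image of \<open>x\<close> under a member of \<open>F\<close>, and 0 otherwise.\<close>
  define c :: "'a \<Rightarrow> 'a \<Rightarrow> real" where
    "c = (\<lambda>x' y. if x' = x then indicator ((\<lambda>k. k x) ` F) y else 0)"
  have "indicator F g =
      (\<Sum>x'\<in>\<Omega>. \<Sum>y\<in>\<Omega>. c x' y * indicator (canonical_intersecting G x' y) g)"
    if g: "g \<in> G" for g
  proof -
    have "g x \<in> \<Omega>"
      using g x subgroup.subset[OF assms(2)] by (auto simp: BijGroup_def Bij_def bij_betw_def)
    \<comment> \<open>From left to right, some \<open>k\<close> in \<open>F\<close> agrees with
      \<open>g\<close> at \<open>x\<close>, so maximality puts \<open>g\<close> in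
      \<open>F\<close>.\<close>
    have mem_iff: "g x \<in> (\<lambda>k. k x) ` F \<longleftrightarrow> g \<in> F"
      using max_intersecting_absorbs_agreeing[OF assms(1,2,5) F g _ x] by blast
    have "(\<Sum>x'\<in>\<Omega>. \<Sum>y\<in>\<Omega>. c x' y * indicator (canonical_intersecting G x' y) g)
        = (\<Sum>x'\<in>\<Omega>. if x' = x then \<Sum>y\<in>\<Omega>. c x y * indicator (canonical_intersecting G x y) g else 0)"
      by (intro sum.cong) (auto simp: c_def)
    also have "\<dots> = (\<Sum>y\<in>\<Omega>. c x y * indicator (canonical_intersecting G x y) g)"
      using x assms(1) by simp
    \<comment> \<open>Among the canonical sets with source \<open>x\<close>, only the one with
      target \<open>g x\<close> contains \<open>g\<close>.\<close>
    also have "\<dots> = (\<Sum>y\<in>\<Omega>. if y = g x then c x (g x) else 0)"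
      using g by (intro sum.cong) (auto simp: canonical_intersecting_def indicator_def)
    also have "\<dots> = indicator ((\<lambda>k. k x) ` F) (g x)"
      using \<open>g x \<in> \<Omega>\<close> assms(1) by (simp add: c_def)
    also have "\<dots> = indicator F g"
      by (simp only: indicator_def mem_iff)
    finally show ?thesis by simp
  qed
  then show "\<exists>c :: 'a \<Rightarrow> 'a \<Rightarrow> real. \<forall>g\<in>G. indicator F g =
      (\<Sum>x\<in>\<Omega>. \<Sum>y\<in>\<Omega>. c x y * indicator (canonical_intersecting G x y) g)"
    by blast
qed

end
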